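(* Let $c_0,c_1>0$. 1) $(Z^{c_0,c_1}_t,N^{c_0,c_1}_t;\ t\ge0)$ is an $\mathbb R\times\mathbb N$-valued Markov process. 2) Let $s\ge0$ and $n\ge0$. Conditionally on $Z^{c_0,c_1}_s=x$ and $N^{c_0,c_1}_s=n$, the process $\big((Z^{c_0,c_1}_{t+s},N^{c_0,c_1}_{t+s}),\ t\ge0\big)$ is distributed as $$\Big(\Big(x+\int_0^t(-1)^{N^{c_0,c_1}_u}du,\ n+N^{c_0,c_1}_t\Big),\ t\ge0\Big)\quad\text{when } n \text{ is even},$$ and as $$\Big(\Big(x-\int_0^t(-1)^{N^{c_1,c_0}_u}du,\ n+N^{c_1,c_0}_t\Big),\ t\ge0\Big)\quad\text{when } n\text{ is odd}.$$
   Context: For $a,b>0$: let $(e_n)_{n\ge1}$ be i.i.d. exponential random variables with $\mathbb E[e_n]=1$, let $\lambda_k=1/a$ if $k$ is odd and $\lambda_k=1/b$ if $k$ is even, and set $$N^{a,b}_t=\sum_{k\ge1}1_{\{\lambda_1e_1+\dots+\lambda_ke_k\le t\}},\qquad Z^{a,b}_t=\int_0^t(-1)^{N^{a,b}_u}\,du,\qquad t\ge0.$$ *)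

theory Defs
  imports "HOL-Probability.Probability"
begin

definition jump_scale :: "real \<Rightarrow> real \<Rightarrow> nat \<Rightarrow> real" where
  "jump_scale a b k = (if odd k then 1 / a else 1 / b)"

text \<open>
  The variables \<^term>\<open>e k\<close> are only used for \<open>k \<ge> 1\<close>.  On the null event where
  infinitely many jump times lie in \<open>[0,t]\<close>, \<^const>\<open>card\<close> makes \<open>N_proc\<close> equal to 0.
\<close>
definition N_proc :: "(nat \<Rightarrow> 'a \<Rightarrow> real) \<Rightarrow> real \<Rightarrow> real \<Rightarrow> real \<Rightarrow> 'a \<Rightarrow> nat" where
  "N_proc e a b t \<omega> = card {k. 1 \<le> k \<and> (\<Sum>i=1..k. jump_scale a b i * e i \<omega>) \<le> t}"

definition Z_proc :: "(nat \<Rightarrow> 'a \<Rightarrow> real) \<Rightarrow> real \<Rightarrow> real \<Rightarrow> real \<Rightarrow> 'a \<Rightarrow> real" where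
  "Z_proc e a b t \<omega> = (LBINT u:{0..t}. (-1) ^ N_proc e a b u \<omega>)"

definition natural_filtration ::
    "'a measure \<Rightarrow> 'b measure \<Rightarrow> (real \<Rightarrow> 'a \<Rightarrow> 'b) \<Rightarrow> real \<Rightarrow> 'a measure" where
  "natural_filtration M S X s =
     sigma (space M) {X u -` A \<inter> space M | u A. 0 \<le> u \<and> u \<le> s \<and> A \<in> sets S}"

text \<open>
  The Markov property with respect to the natural filtration, for a process indexed by
  \<open>[0,\<infinity>)\<close> with state space \<open>S\<close>: the conditional expectation of \<open>f (X t)\<close> given the
  past up to time \<open>s\<close> is its conditional expectation given \<open>X s\<close>.
\<close>
definition markov_process :: "'a measure \<Rightarrow> 'b measure \<Rightarrow> (real \<Rightarrow> 'a \<Rightarrow> 'b) \<Rightarrow> bool" where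
  "markov_process M S X \<longleftrightarrow>
     (\<forall>t\<ge>0. X t \<in> M \<rightarrow>\<^sub>M S) \<and>
     (\<forall>s\<ge>0. \<forall>t\<ge>s. \<forall>f :: 'b \<Rightarrow> real. f \<in> borel_measurable S \<and> bounded (f ` space S) \<longrightarrow>
       (AE \<omega> in M.
          real_cond_exp M (natural_filtration M S X s) (\<lambda>\<omega>. f (X t \<omega>)) \<omega> =
          real_cond_exp M (vimage_algebra (space M) (X s) S) (\<lambda>\<omega>. f (X t \<omega>)) \<omega>))"

text \<open>
  The probability kernel \<open>K\<close> from \<open>S\<close> to \<open>T\<close> is a regular conditional distribution of
  \<open>Y\<close> given \<open>X\<close>: conditionally on \<open>X = x\<close>, \<open>Y\<close> has law \<open>K x\<close>.
\<close>
definition cond_distributed ::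
    "'a measure \<Rightarrow> 'b measure \<Rightarrow> ('a \<Rightarrow> 'b) \<Rightarrow> 'c measure \<Rightarrow> ('a \<Rightarrow> 'c) \<Rightarrow> ('b \<Rightarrow> 'c measure) \<Rightarrow> bool"
  where
  "cond_distributed M S X T Y K \<longleftrightarrow>
     X \<in> M \<rightarrow>\<^sub>M S \<and> Y \<in> M \<rightarrow>\<^sub>M T \<and> K \<in> S \<rightarrow>\<^sub>M prob_algebra T \<and>
     (\<forall>A\<in>sets T. AE \<omega> in M.
        real_cond_exp M (vimage_algebra (space M) X S) (\<lambda>\<omega>. indicator A (Y \<omega>)) \<omega> =
        measure (K (X \<omega>)) A)"

abbreviation state_space :: "(real \<times> nat) measure" where
  "state_space \<equiv> borel \<Otimes>\<^sub>M count_space UNIV"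

text \<open>
  Laws of processes indexed by \<open>[0,\<infinity>)\<close> are measures on the product (cylinder)
  sigma-algebra.  Its elements are functions that are \<^const>\<open>undefined\<close> at negative
  times, so paths have to be restricted to \<open>{0..}\<close>.
\<close>
abbreviation path_space :: "(real \<Rightarrow> real \<times> nat) measure" where
  "path_space \<equiv> (\<Pi>\<^sub>M t\<in>{0..}. state_space)"

end

theory Submission
  imports Defs
begin

text \<open>
  The jump times of the process are partial sums of independent exponential variables, and the
  theorem is the lack of memory of the exponential law, used at the deterministic time \<open>s\<close>.

  Split the probability space according to the number \<open>n\<close> of jumps made by time \<open>s\<close>.  On the event
  that there are \<open>n\<close> of them, everything up to time \<open>s\<close> is a function of the first \<open>n\<close> waiting times
  (\<open>past_event_first_waits\<close>), while everything after time \<open>s\<close> is obtained by running the same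
  construction from the state at time \<open>s\<close> with the sequence of \<^emph>\<open>residual\<close> waiting times
  (\<open>restart_residual\<close>): the first of these is what remains at time \<open>s\<close> of waiting time \<open>n + 1\<close>, the others
  are the subsequent waiting times.  If \<open>n\<close> is odd, the
  two rates are swapped and the sign of the integrand is reversed; this accounts for the two
  cases of the kernel.

  The event itself says that waiting time \<open>n + 1\<close> exceeds a nonnegative threshold that depends only
  on the first \<open>n\<close> of them.  Since an exponential variable conditioned to exceed a threshold exceeds it by
  an amount with the same exponential law, the residual sequence is, on this event, independent of
  the first \<open>n\<close> waiting times and distributed like the original sequence
  (\<open>memoryless_restart\<close>).  Almost surely exactly one \<open>n\<close> occurs, because
  the jump times increase to infinity (\<open>AE_regular\<close>), so summing over \<open>n\<close> gives
  the expectation of a nonnegative function of the future on any event of the past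
  (\<open>nn_integral_future\<close>).

  The resulting conditional expectation depends on the past only through the current state.
  It is therefore a version of the conditional expectation given any sub-sigma-algebra that lies
  between the one generated by the current state and the natural filtration
  (\<open>cond_exp_future\<close>).  The two extreme choices give the Markov property, and the smaller one
  gives the conditional law of the future.
\<close>

section \<open>The path of the process as a function of the waiting times\<close>

definition jump_time :: "real \<Rightarrow> real \<Rightarrow> (nat \<Rightarrow> real) \<Rightarrow> nat \<Rightarrow> real" where
  "jump_time a b w k = (\<Sum>i=1..k. jump_scale a b i * w i)"

abbreviation N_path :: "real \<Rightarrow> real \<Rightarrow> real \<Rightarrow> (nat \<Rightarrow> real) \<Rightarrow> nat" where
  "N_path \<equiv> N_proc (\<lambda>k w. w k)"

abbreviation Z_path :: "real \<Rightarrow> real \<Rightarrow> real \<Rightarrow> (nat \<Rightarrow> real) \<Rightarrow> real" where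
  "Z_path \<equiv> Z_proc (\<lambda>k w. w k)"

text \<open>
  Almost every sequence of waiting times is regular.  Without the second condition infinitely many jump times
  may lie in a bounded interval, where \<^const>\<open>card\<close> loses the count.
\<close>
definition regular :: "real \<Rightarrow> real \<Rightarrow> (nat \<Rightarrow> real) \<Rightarrow> bool" where
  "regular a b w \<longleftrightarrow> (\<forall>k\<ge>1. 0 < w k) \<and> (\<forall>t. \<exists>k. t < jump_time a b w k)"

definition between_jumps :: "real \<Rightarrow> real \<Rightarrow> real \<Rightarrow> (nat \<Rightarrow> real) \<Rightarrow> nat \<Rightarrow> bool" where
  "between_jumps a b s w n \<longleftrightarrow> jump_time a b w n \<le> s \<and> s < jump_time a b w (Suc n)"

text \<open>
  The waiting times of the process seen from time \<open>s\<close>, when \<open>n\<close> jumps have occurred by then.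
  The restriction to positive indices makes it a point of the product space that carries
  the law of the waiting times.
\<close>
definition residual :: "real \<Rightarrow> real \<Rightarrow> real \<Rightarrow> nat \<Rightarrow> (nat \<Rightarrow> real) \<Rightarrow> nat \<Rightarrow> real" where
  "residual a b s n w =
     (\<lambda>k\<in>{1..}. w (n + k))(1 := w (Suc n) - (s - jump_time a b w n) / jump_scale a b (Suc n))"

text \<open>
  Only the first \<open>n\<close> waiting times are kept; each of the others is replaced by one that lasts
  \<open>s + 1\<close> units of time after scaling, so that no further jump happens by time \<open>s\<close>.  This displays
  the path up to time \<open>s\<close> as a function of finitely many waiting times without a second
  definition of the process.
\<close>
definition freeze :: "real \<Rightarrow> real \<Rightarrow> real \<Rightarrow> nat \<Rightarrow> (nat \<Rightarrow> real) \<Rightarrow> nat \<Rightarrow> real" where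
  "freeze a b s n u = (\<lambda>k. if k \<in> {1..n} then u k else (s + 1) / jump_scale a b k)"

lemma jump_scale_pos: "0 < a \<Longrightarrow> 0 < b \<Longrightarrow> 0 < jump_scale a b k"
  by (simp add: jump_scale_def)

lemma jump_time_0 [simp]: "jump_time a b w 0 = 0"
  by (simp add: jump_time_def)

lemma jump_time_Suc: "jump_time a b w (Suc k) = jump_time a b w k + jump_scale a b (Suc k) * w (Suc k)"
  by (simp add: jump_time_def)

lemma jump_time_cong: "(\<And>k. k \<in> {1..n} \<Longrightarrow> w k = w' k) \<Longrightarrow> jump_time a b w n = jump_time a b w' n"
  by (auto simp: jump_time_def intro!: sum.cong)

lemma N_proc_eq: "N_proc e a b t \<omega> = card {k. 1 \<le> k \<and> jump_time a b (\<lambda>k. e k \<omega>) k \<le> t}"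
  by (simp add: N_proc_def jump_time_def)

text \<open>
  Passing to the space of sequences: the process depends on the sample point only
  through the waiting times with positive index.
\<close>
lemma N_proc_path:
  assumes "\<And>k. 1 \<le> k \<Longrightarrow> w k = e k \<omega>"
  shows "N_proc e a b t \<omega> = N_path a b t w"
proof -
  have "jump_time a b (\<lambda>k. e k \<omega>) k = jump_time a b w k" for k
    using assms by (intro jump_time_cong) auto
  thus ?thesis by (simp add: N_proc_eq)
qed

lemma Z_proc_path:
  assumes "\<And>k. 1 \<le> k \<Longrightarrow> w k = e k \<omega>"
  shows "Z_proc e a b t \<omega> = Z_path a b t w"
  unfolding Z_proc_def using N_proc_path[of w e \<omega>, OF assms] by simp

lemma strict_mono_jump_time:
  assumes "0 < a" "0 < b" "\<And>k. 1 \<le> k \<Longrightarrow> 0 < w k"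
  shows "strict_mono (jump_time a b w)"
  using assms by (intro strict_mono_Suc_iff[THEN iffD2]) (auto simp: jump_time_Suc jump_scale_pos)

lemma regular_strict_mono:
  "0 < a \<Longrightarrow> 0 < b \<Longrightarrow> regular a b w \<Longrightarrow> strict_mono (jump_time a b w)"
  by (rule strict_mono_jump_time) (auto simp: regular_def)

text \<open>
  Here unboundedness of the jump times is used: the first jump after time \<open>s\<close> exists.
\<close>
lemma between_jumps_exists:
  assumes "regular a b w" "0 \<le> s"
  obtains n where "between_jumps a b s w n"
proof -
  define k where "k = (LEAST k. s < jump_time a b w k)"
  have "\<exists>k. s < jump_time a b w k" using assms by (simp add: regular_def)
  hence k: "s < jump_time a b w k" unfolding k_def by (rule LeastI_ex)
  have "k \<noteq> 0" using k assms(2) by (intro notI) simp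
  then obtain n where n: "k = Suc n" by (cases k) auto
  have "\<not> s < jump_time a b w n" using not_less_Least[of n "\<lambda>k. s < jump_time a b w k"] n unfolding k_def by auto
  thus ?thesis using that[of n] k n by (simp add: between_jumps_def)
qed

lemma between_jumps_le_iff:
  assumes "strict_mono (jump_time a b w)" "between_jumps a b s w n"
  shows "jump_time a b w k \<le> s \<longleftrightarrow> k \<le> n"
proof
  assume "jump_time a b w k \<le> s"
  hence "jump_time a b w k < jump_time a b w (Suc n)" using assms(2) by (simp add: between_jumps_def)
  thus "k \<le> n" using strict_mono_less[OF assms(1)] by auto
next
  assume "k \<le> n"
  hence "jump_time a b w k \<le> jump_time a b w n" using strict_mono_less_eq[OF assms(1)] by auto
  thus "jump_time a b w k \<le> s" using assms(2) by (simp add: between_jumps_def)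
qed

lemma between_jumps_unique:
  assumes "strict_mono (jump_time a b w)" "between_jumps a b s w n" "between_jumps a b s w m"
  shows "m = n"
proof (rule order_antisym)
  show "m \<le> n" using between_jumps_le_iff[OF assms(1,2), of m] between_jumps_le_iff[OF assms(1,3), of m] by simp
  show "n \<le> m" using between_jumps_le_iff[OF assms(1,2), of n] between_jumps_le_iff[OF assms(1,3), of n] by simp
qed

lemma N_path_renewal_at:
  assumes "strict_mono (jump_time a b w)" "between_jumps a b s w n"
  shows "N_path a b s w = n"
proof -
  have "{k. 1 \<le> k \<and> jump_time a b w k \<le> s} = {1..n}"
    unfolding between_jumps_le_iff[OF assms] by auto
  thus ?thesis unfolding N_proc_eq by (simp only: card_atLeastAtMost diff_Suc_1)
qed

lemma jump_scale_shift:
  "jump_scale a b (n + k) = jump_scale (if even n then a else b) (if even n then b else a) k"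
  by (cases "even n"; cases "even k") (simp_all add: jump_scale_def)

text \<open>
  Induction on \<open>k\<close>.  In the base case, subtracting the scaled elapsed time from the current
  waiting time moves the origin of time to \<open>s\<close>; the later increments are unchanged.
\<close>
lemma jump_time_residual:
  assumes "0 < a" "0 < b" "1 \<le> k"
  shows "jump_time (if even n then a else b) (if even n then b else a) (residual a b s n w) k =
         jump_time a b w (n + k) - s"
  using assms(3)
proof (induction k rule: dec_induct)
  case base
  have "jump_scale a b (Suc n) > 0" using assms by (intro jump_scale_pos)
  thus ?case using jump_scale_shift[of a b n 1]
    by (simp add: jump_time_Suc residual_def field_simps)
next
  case (step k)
  thus ?case using jump_scale_shift[of a b n "Suc k"]
    by (simp add: jump_time_Suc residual_def)
qed

text \<open>
  The jumps by time \<open>t + s\<close> are the first \<open>n\<close> together with the jumps of the restarted path by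
  time \<open>t\<close>, shifted by \<open>n\<close>.  Finiteness, without which \<^const>\<open>card\<close> would not be
  additive, comes from regularity.
\<close>
lemma N_path_shift:
  assumes "0 < a" "0 < b" "regular a b w" "between_jumps a b s w n" "0 \<le> t"
  shows "N_path a b (t + s) w =
    n + N_path (if even n then a else b) (if even n then b else a) t (residual a b s n w)"
    (is "_ = n + N_path ?a ?b t ?r")
proof -
  note mono = regular_strict_mono[OF assms(1-3)]
  define A where "A = {k. 1 \<le> k \<and> jump_time ?a ?b ?r k \<le> t}"
  have A: "A = {k. 1 \<le> k \<and> jump_time a b w (n + k) \<le> t + s}"
    unfolding A_def using jump_time_residual[OF assms(1,2), of _ n s w] by auto
  have eq: "{k. 1 \<le> k \<and> jump_time a b w k \<le> t + s} = {1..n} \<union> (+) n ` A" (is "?L = ?R")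
  proof (intro equalityI subsetI)
    fix k assume k: "k \<in> ?L"
    show "k \<in> ?R"
    proof (cases "k \<le> n")
      case False
      hence "k = n + (k - n)" "1 \<le> k - n" by auto
      thus ?thesis using k A by (metis (no_types, lifting) UnI2 image_eqI mem_Collect_eq)
    qed (use k in auto)
  next
    fix k assume "k \<in> ?R"
    moreover have "jump_time a b w j \<le> t + s" if "j \<le> n" for j
      using between_jumps_le_iff[OF mono assms(4), of j] that assms(5) by auto
    ultimately show "k \<in> ?L" using A by auto
  qed
  obtain m where m: "t + s < jump_time a b w m" using assms(3) by (auto simp: regular_def)
  have "?L \<subseteq> {..m}"
  proof
    fix k assume "k \<in> ?L"
    hence "jump_time a b w k < jump_time a b w m" using m by auto
    thus "k \<in> {..m}" using strict_mono_less[OF mono] by auto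
  qed
  hence "finite ?L" by (rule finite_subset) simp
  hence "finite ((+) n ` A)" unfolding eq by simp
  hence "card ?L = n + card A"
    unfolding eq by (subst card_Un_disjoint) (auto simp: A card_image)
  thus ?thesis unfolding N_proc_eq A_def .
qed

text \<open>
  Joint measurability in time and sample point is what makes the integral over time
  a measurable function of the sample point.
\<close>
lemma measurable_N_proc:
  assumes e: "\<And>k. 1 \<le> k \<Longrightarrow> e k \<in> borel_measurable M"
  shows "(\<lambda>(u, \<omega>). N_proc e a b u \<omega>) \<in> borel \<Otimes>\<^sub>M M \<rightarrow>\<^sub>M count_space UNIV"
proof -
  have [measurable]:
    "(\<lambda>x. \<Sum>i=1..k. jump_scale a b i * e i (snd x)) \<in> borel_measurable (borel \<Otimes>\<^sub>M M)" for k
  proof (intro borel_measurable_sum borel_measurable_times borel_measurable_const)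
    fix i assume "i \<in> {1..k}"
    thus "(\<lambda>x. e i (snd x)) \<in> borel_measurable (borel \<Otimes>\<^sub>M M)"
      using e by (intro measurable_compose[OF measurable_snd]) auto
  qed
  show ?thesis
    unfolding N_proc_def case_prod_beta by measurable
qed

lemma measurable_N_proc_compose:
  assumes "\<And>k. 1 \<le> k \<Longrightarrow> e k \<in> borel_measurable M"
    and "f \<in> borel_measurable L" "g \<in> L \<rightarrow>\<^sub>M M"
  shows "(\<lambda>x. N_proc e a b (f x) (g x)) \<in> L \<rightarrow>\<^sub>M count_space UNIV"
  using measurable_compose[OF measurable_Pair[OF assms(2,3)] measurable_N_proc[of e M a b, OF assms(1)]]
  by simp

lemma measurable_Z_proc:
  assumes [measurable]: "\<And>k. 1 \<le> k \<Longrightarrow> e k \<in> borel_measurable M"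
  shows "Z_proc e a b t \<in> borel_measurable M"
proof -
  have [measurable]: "(\<lambda>x. N_proc e a b (snd x) (fst x)) \<in> M \<Otimes>\<^sub>M lborel \<rightarrow>\<^sub>M count_space UNIV"
    using assms by (rule measurable_N_proc_compose) (auto simp: measurable_lborel2)
  show ?thesis
    unfolding Z_proc_def set_lebesgue_integral_def case_prod_beta by measurable
qed

lemma set_integrable_sign:
  fixes N :: "real \<Rightarrow> nat"
  assumes [measurable]: "N \<in> borel \<rightarrow>\<^sub>M count_space UNIV" and "A \<in> sets borel" "emeasure lborel A < \<infinity>"
  shows "set_integrable lborel A (\<lambda>u. (-1) ^ N u :: real)"
proof -
  have "integrable lborel (indicator A :: real \<Rightarrow> real)"
    using assms by (simp add: integrable_indicator_iff)
  thus ?thesis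
    unfolding set_integrable_def using assms
    by (elim Bochner_Integration.integrable_bound) (auto simp: power_abs indicator_def)
qed

lemma measurable_N_path_time: "(\<lambda>u. N_path a b u w) \<in> borel \<rightarrow>\<^sub>M count_space UNIV"
  unfolding N_proc_def by measurable

text \<open>
  Cut the integral at \<open>s\<close> and translate the second part; there the integrand is
  \<open>(-1) ^ n\<close> times that of the restarted path, by \<open>N_path_shift\<close>.
\<close>
lemma Z_path_shift:
  assumes "0 < a" "0 < b" "regular a b w" "between_jumps a b s w n" "0 \<le> s" "0 \<le> t"
  shows "Z_path a b (t + s) w = Z_path a b s w +
    (-1) ^ n * Z_path (if even n then a else b) (if even n then b else a) t (residual a b s n w)"
    (is "_ = _ + _ * Z_path ?a ?b t ?r")
proof -
  let ?f = "\<lambda>u. (-1) ^ N_path a b u w :: real"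
  note [measurable] = measurable_N_path_time
  have "{0..t + s} = {0..s} \<union> {s..t + s}" using assms(5,6) by auto
  hence "Z_path a b (t + s) w = (LBINT u:{0..s}\<union>{s..t + s}. ?f u)"
    by (simp add: Z_proc_def)
  also have "\<dots> = (LBINT u:{0..s}. ?f u) + (LBINT u:{s..t + s}. ?f u)"
  proof (rule set_integral_Un_AE)
    have "AE u in lborel. u \<noteq> s" by (rule AE_lborel_singleton)
    thus "AE u in lborel. \<not> (u \<in> {0..s} \<and> u \<in> {s..t + s})" by eventually_elim auto
  qed (auto intro!: set_integrable_sign simp: emeasure_lborel_Icc_eq)
  also have "(LBINT u:{s..t + s}. ?f u) = (LBINT u:{0..t}. ?f (u + s))"
    unfolding set_lebesgue_integral_def
    by (subst lborel_integral_real_affine[of 1 _ s])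
       (auto intro!: Bochner_Integration.integral_cong simp: indicator_def add.commute)
  also have "\<dots> = (LBINT u:{0..t}. (-1) ^ n * (-1) ^ N_path ?a ?b u ?r)"
    by (intro set_lebesgue_integral_cong) (auto simp: N_path_shift[OF assms(1-4)] power_add)
  finally show ?thesis by (simp add: Z_proc_def)
qed

text \<open>
  In both sequences the first \<open>n\<close> jump times agree and all later ones exceed \<open>s\<close>.
\<close>
lemma N_path_freeze:
  assumes "0 < a" "0 < b" "0 \<le> s" "\<And>k. 1 \<le> k \<Longrightarrow> 0 < w k" "between_jumps a b s w n" "u \<le> s"
    and "\<And>k. k \<in> {1..n} \<Longrightarrow> v k = w k"
  shows "N_path a b u (freeze a b s n v) = N_path a b u w"
proof -
  let ?v = "freeze a b s n v"
  have pos: "0 < ?v k" if "1 \<le> k" for k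
    using that assms(3,4,7) jump_scale_pos[OF assms(1,2)] by (auto simp: freeze_def)
  note mv = strict_mono_jump_time[of a b ?v, OF assms(1,2) pos]
  note mw = strict_mono_jump_time[of a b w, OF assms(1,2,4)]
  have eq: "jump_time a b ?v k = jump_time a b w k" if "k \<le> n" for k
    using that assms(7) by (intro jump_time_cong) (auto simp: freeze_def)
  have "jump_time a b w n \<ge> jump_time a b w 0" using strict_mono_less_eq[OF mw, of 0 n] by simp
  moreover have "jump_scale a b (Suc n) * ?v (Suc n) = s + 1"
    using jump_scale_pos[OF assms(1,2), of "Suc n"] by (simp add: freeze_def)
  ultimately have ren: "between_jumps a b s ?v n"
    using assms(5) eq[of n] by (simp add: between_jumps_def jump_time_Suc)
  have "jump_time a b ?v k \<le> u \<longleftrightarrow> jump_time a b w k \<le> u" for k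
  proof (cases "k \<le> n")
    case False
    hence "\<not> jump_time a b ?v k \<le> s" "\<not> jump_time a b w k \<le> s"
      using between_jumps_le_iff[OF mv ren] between_jumps_le_iff[OF mw assms(5)] by auto
    thus ?thesis using assms(6) by auto
  qed (simp add: eq)
  thus ?thesis unfolding N_proc_eq by simp
qed

lemma Z_path_freeze:
  assumes "0 < a" "0 < b" "0 \<le> s" "\<And>k. 1 \<le> k \<Longrightarrow> 0 < w k" "between_jumps a b s w n" "u \<le> s"
    and "\<And>k. k \<in> {1..n} \<Longrightarrow> v k = w k"
  shows "Z_path a b u (freeze a b s n v) = Z_path a b u w"
  unfolding Z_proc_def
proof (intro set_lebesgue_integral_cong allI impI)
  fix t assume "t \<in> {0..u}"
  thus "(-1) ^ N_path a b t (freeze a b s n v) = ((-1) ^ N_path a b t w :: real)"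
    using N_path_freeze[OF assms(1-5) _ assms(7), of t] assms(6) by simp
qed simp

section \<open>Sequences of independent exponential waiting times\<close>

declare One_nat_def [simp del]

text \<open>
  \<open>exp_law\<close> is the standard exponential law, and \<open>waiting_law\<close> its infinite product, the law of the
  whole sequence of waiting times.
\<close>
definition exp_law :: "real measure" where
  "exp_law = density lborel (exponential_density 1)"

definition waiting_law :: "(nat \<Rightarrow> real) measure" where
  "waiting_law = (\<Pi>\<^sub>M k\<in>{1..}. exp_law)"

lemma sets_exp_law [measurable_cong, simp]: "sets exp_law = sets borel"
  by (simp add: exp_law_def)

lemma sets_waiting_law [measurable_cong]: "sets waiting_law = sets (\<Pi>\<^sub>M k\<in>{1..}. borel)"
  unfolding waiting_law_def by (intro sets_PiM_cong) auto

lemma prob_space_exp_law: "prob_space exp_law"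
  unfolding exp_law_def by (rule prob_space_exponential_density) simp

lemma prob_space_waiting_law: "prob_space waiting_law"
  unfolding waiting_law_def by (intro prob_space_PiM prob_space_exp_law)

text \<open>
  The lack of memory of the exponential law in integral form: the density at \<open>d + v\<close> is \<open>exp (- d)\<close>
  times the density at \<open>v\<close>.
\<close>
lemma nn_integral_exp_law_shift:
  assumes [measurable]: "g \<in> borel_measurable borel" and "0 \<le> d"
  shows "(\<integral>\<^sup>+v. indicator {d<..} v * g (v - d) \<partial>exp_law) = ennreal (exp (- d)) * (\<integral>\<^sup>+v. g v \<partial>exp_law)"
proof -
  have "(\<integral>\<^sup>+v. indicator {d<..} v * g (v - d) \<partial>exp_law)
      = (\<integral>\<^sup>+v. exponential_density 1 v * (indicator {d<..} v * g (v - d)) \<partial>lborel)"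
    unfolding exp_law_def by (subst nn_integral_density) auto
  also have "\<dots> = (\<integral>\<^sup>+v. exponential_density 1 (d + v) * (indicator {d<..} (d + v) * g v) \<partial>lborel)"
    by (subst nn_integral_real_affine[where c=1 and t=d]) auto
  also have "\<dots> = (\<integral>\<^sup>+v. ennreal (exp (- d)) * (exponential_density 1 v * g v) \<partial>lborel)"
  proof (rule nn_integral_cong_AE)
    have "AE v in lborel. v \<noteq> (0::real)" by (rule AE_lborel_singleton)
    thus "AE v in lborel. exponential_density 1 (d + v) * (indicator {d<..} (d + v) * g v)
        = ennreal (exp (- d)) * (exponential_density 1 v * g v)"
    proof eventually_elim
      case (elim v)
      show ?case
      proof (cases "v < 0")
        case False
        with elim have "v > 0" by simp
        hence "exponential_density 1 (d + v) = exp (- d) * exponential_density 1 v"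
          using assms(2) by (simp add: exponential_density_def flip: exp_add)
        thus ?thesis using \<open>v > 0\<close> by (simp add: ennreal_mult' mult.assoc)
      qed (simp add: exponential_density_def)
    qed
  qed
  also have "\<dots> = ennreal (exp (- d)) * (\<integral>\<^sup>+v. exponential_density 1 v * g v \<partial>lborel)"
    by (rule nn_integral_cmult) auto
  also have "(\<integral>\<^sup>+v. exponential_density 1 v * g v \<partial>lborel) = (\<integral>\<^sup>+v. g v \<partial>exp_law)"
    unfolding exp_law_def by (subst nn_integral_density) auto
  finally show ?thesis .
qed

text \<open>
  Separating the first coordinate, the only one that a shift of the time origin changes,
  reduces statements about the whole sequence to the exponential law.
\<close>
lemma nn_integral_waiting_law_split:
  assumes [measurable]: "g \<in> borel_measurable (\<Pi>\<^sub>M k\<in>{1..}. borel)"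
  shows "(\<integral>\<^sup>+w. g w \<partial>waiting_law)
       = (\<integral>\<^sup>+w. \<integral>\<^sup>+v. g (w(1 := v)) \<partial>exp_law \<partial>(\<Pi>\<^sub>M k\<in>{2..}. exp_law))"
proof -
  interpret E: prob_space exp_law by (rule prob_space_exp_law)
  interpret T: prob_space "\<Pi>\<^sub>M k\<in>{2::nat..}. exp_law" by (intro prob_space_PiM prob_space_exp_law)
  interpret pair_sigma_finite exp_law "\<Pi>\<^sub>M k\<in>{2::nat..}. exp_law" ..
  have ins: "insert (1::nat) {2..} = {1..}" by auto
  have upd [measurable]: "(\<lambda>(v, w). w(1 := v)) \<in> exp_law \<Otimes>\<^sub>M (\<Pi>\<^sub>M k\<in>{2::nat..}. exp_law) \<rightarrow>\<^sub>M waiting_law"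
    unfolding waiting_law_def case_prod_beta
    by (rule measurable_fun_upd[where J="{2..}"]) auto
  have g [measurable]: "g \<in> borel_measurable waiting_law" by measurable
  have "waiting_law = distr (exp_law \<Otimes>\<^sub>M (\<Pi>\<^sub>M k\<in>{2::nat..}. exp_law)) waiting_law (\<lambda>(v, w). w(1 := v))"
    unfolding waiting_law_def ins[symmetric]
    by (rule distr_pair_PiM_eq_PiM[symmetric]) (rule prob_space_exp_law)+
  hence "(\<integral>\<^sup>+w. g w \<partial>waiting_law)
      = (\<integral>\<^sup>+w. g w \<partial>distr (exp_law \<Otimes>\<^sub>M (\<Pi>\<^sub>M k\<in>{2::nat..}. exp_law)) waiting_law (\<lambda>(v, w). w(1 := v)))"
    by simp
  also have "\<dots> = (\<integral>\<^sup>+x. g ((snd x)(1 := fst x)) \<partial>(exp_law \<Otimes>\<^sub>M (\<Pi>\<^sub>M k\<in>{2::nat..}. exp_law)))"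
    by (subst nn_integral_distr[OF upd]) (simp_all only: case_prod_beta measurable_distr_eq1 g)
  also have "\<dots> = (\<integral>\<^sup>+w. \<integral>\<^sup>+v. g (w(1 := v)) \<partial>exp_law \<partial>(\<Pi>\<^sub>M k\<in>{2..}. exp_law))"
    using nn_integral_snd[of "\<lambda>x. g ((snd x)(1 := fst x))"]
      measurable_compose[OF upd g] by (simp only: case_prod_beta fst_conv snd_conv)
  finally show ?thesis .
qed

lemma nn_integral_waiting_law_shift:
  assumes [measurable]: "g \<in> borel_measurable (\<Pi>\<^sub>M k\<in>{1..}. borel)" and "0 \<le> d"
  shows "(\<integral>\<^sup>+w. indicator {d<..} (w 1) * g (w(1 := w 1 - d)) \<partial>waiting_law)
       = ennreal (exp (- d)) * (\<integral>\<^sup>+w. g w \<partial>waiting_law)"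
proof -
  let ?T = "\<Pi>\<^sub>M k\<in>{2::nat..}. exp_law"
  interpret E: prob_space exp_law by (rule prob_space_exp_law)
  have upd: "(\<lambda>x. (snd x)(1 := fst x)) \<in> borel \<Otimes>\<^sub>M ?T \<rightarrow>\<^sub>M (\<Pi>\<^sub>M k\<in>{1..}. borel)"
  proof (rule measurable_fun_upd[where J="{2..}"])
    show "snd \<in> borel \<Otimes>\<^sub>M ?T \<rightarrow>\<^sub>M (\<Pi>\<^sub>M k\<in>{2..}. borel)"
      using measurable_snd measurable_cong_sets[OF refl sets_PiM_cong[OF refl sets_exp_law]] by blast
  qed auto
  have [measurable]: "(\<lambda>w. w(1 := w 1 - d)) \<in> (\<Pi>\<^sub>M k\<in>{1::nat..}. borel) \<rightarrow>\<^sub>M (\<Pi>\<^sub>M k\<in>{1..}. borel)"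
    by (rule measurable_fun_upd[where J="{1..}"]) auto
  have gu: "(\<lambda>v. g (w(1 := v))) \<in> borel_measurable borel" if "w \<in> space ?T" for w
    using measurable_compose[OF measurable_compose[OF measurable_Pair2'[OF that] upd] assms(1)]
    by simp
  have m: "(\<lambda>w. \<integral>\<^sup>+v. g (w(1 := v)) \<partial>exp_law) \<in> borel_measurable ?T"
  proof (rule E.borel_measurable_nn_integral)
    have "(\<lambda>x. (snd x, fst x)) \<in> ?T \<Otimes>\<^sub>M exp_law \<rightarrow>\<^sub>M borel \<Otimes>\<^sub>M ?T" by measurable
    from measurable_compose[OF measurable_compose[OF this upd] assms(1)]
    show "(\<lambda>(w, v). g (w(1 := v))) \<in> borel_measurable (?T \<Otimes>\<^sub>M exp_law)"
      by (simp add: case_prod_beta)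
  qed
  have "(\<integral>\<^sup>+w. indicator {d<..} (w 1) * g (w(1 := w 1 - d)) \<partial>waiting_law)
      = (\<integral>\<^sup>+w. \<integral>\<^sup>+v. indicator {d<..} v * g (w(1 := v - d)) \<partial>exp_law \<partial>?T)"
    by (subst nn_integral_waiting_law_split) auto
  also have "\<dots> = (\<integral>\<^sup>+w. ennreal (exp (- d)) * (\<integral>\<^sup>+v. g (w(1 := v)) \<partial>exp_law) \<partial>?T)"
    using gu assms(2) by (intro nn_integral_cong nn_integral_exp_law_shift)
  also have "\<dots> = ennreal (exp (- d)) * (\<integral>\<^sup>+w. \<integral>\<^sup>+v. g (w(1 := v)) \<partial>exp_law \<partial>?T)"
    using m by (rule nn_integral_cmult)
  also have "(\<integral>\<^sup>+w. \<integral>\<^sup>+v. g (w(1 := v)) \<partial>exp_law \<partial>?T) = (\<integral>\<^sup>+w. g w \<partial>waiting_law)"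
    by (rule nn_integral_waiting_law_split[symmetric]) fact
  finally show ?thesis .
qed

text \<open>
  The factor \<open>exp (- d)\<close> of the previous lemma is the probability that the first waiting time
  exceeds \<open>d\<close>, as one sees by taking \<open>g = 1\<close>.
\<close>
lemma nn_integral_waiting_law_memoryless:
  assumes g: "g \<in> borel_measurable (\<Pi>\<^sub>M k\<in>{1..}. borel)" and "0 \<le> d"
  shows "(\<integral>\<^sup>+w. indicator {d<..} (w 1) * g (w(1 := w 1 - d)) \<partial>waiting_law)
       = (\<integral>\<^sup>+w. indicator {d<..} (w 1) * (\<integral>\<^sup>+w'. g w' \<partial>waiting_law) \<partial>waiting_law)"
proof -
  interpret W: prob_space waiting_law by (rule prob_space_waiting_law)
  have "(\<integral>\<^sup>+w. indicator {d<..} (w 1) \<partial>waiting_law) = ennreal (exp (- d))"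
    using nn_integral_waiting_law_shift[of "\<lambda>_. 1" d] assms(2) by (simp add: W.emeasure_space_1)
  moreover have "(\<lambda>w. indicator {d<..} (w 1) :: ennreal) \<in> borel_measurable waiting_law"
    by measurable
  ultimately show ?thesis
    by (simp add: nn_integral_waiting_law_shift[OF assms] nn_integral_multc)
qed

locale exponential_waiting = prob_space M for M :: "'a measure" +
  fixes e :: "nat \<Rightarrow> 'a \<Rightarrow> real"
  assumes indep: "indep_vars (\<lambda>_. borel) e {1..}"
    and exp_distributed: "\<And>k. 1 \<le> k \<Longrightarrow> distributed M lborel (e k) (exponential_density 1)"
begin

lemma measurable_e: "1 \<le> k \<Longrightarrow> e k \<in> borel_measurable M"
  using distributed_measurable[OF exp_distributed] by simp

definition first_waits :: "nat \<Rightarrow> 'a \<Rightarrow> nat \<Rightarrow> real" where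
  "first_waits n \<omega> = (\<lambda>k\<in>{1..n}. e k \<omega>)"

definition later_waits :: "nat \<Rightarrow> 'a \<Rightarrow> nat \<Rightarrow> real" where
  "later_waits n \<omega> = (\<lambda>k\<in>{1..}. e (n + k) \<omega>)"

lemma measurable_first_waits [measurable]: "first_waits n \<in> M \<rightarrow>\<^sub>M (\<Pi>\<^sub>M k\<in>{1..n}. borel)"
  unfolding first_waits_def by (intro measurable_restrict measurable_e) auto

lemma measurable_later_waits [measurable]: "later_waits n \<in> M \<rightarrow>\<^sub>M (\<Pi>\<^sub>M k\<in>{1..}. borel)"
  unfolding later_waits_def by (intro measurable_restrict measurable_e) auto

lemma distr_later_waits: "distr M (\<Pi>\<^sub>M k\<in>{1..}. borel) (later_waits n) = waiting_law"
proof -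
  let ?S = "\<lambda>w. \<lambda>k\<in>{1::nat..}. w (n + k) :: real"
  have eq: "distr M borel (e k) = exp_law" if "1 \<le> k" for k
  proof -
    have "distr M borel (e k) = distr M lborel (e k)" by (rule distr_cong) auto
    thus ?thesis using distributed_distr_eq_density[OF exp_distributed[OF that]]
      by (simp add: exp_law_def)
  qed
  have ind: "indep_vars (\<lambda>_. borel) e {Suc n..}"
    by (rule indep_vars_subset[OF indep]) auto
  have "distr M (\<Pi>\<^sub>M k\<in>{Suc n..}. borel) (\<lambda>\<omega>. \<lambda>k\<in>{Suc n..}. e k \<omega>)
      = (\<Pi>\<^sub>M k\<in>{Suc n..}. distr M borel (e k))"
    by (rule indep_vars_iff_distr_eq_PiM'[THEN iffD1, OF _ _ ind]) (auto intro: measurable_e)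
  also have "\<dots> = (\<Pi>\<^sub>M k\<in>{Suc n..}. exp_law)" using eq by (intro PiM_cong) auto
  finally have tail: "distr M (\<Pi>\<^sub>M k\<in>{Suc n..}. borel) (\<lambda>\<omega>. \<lambda>k\<in>{Suc n..}. e k \<omega>)
      = (\<Pi>\<^sub>M k\<in>{Suc n..}. exp_law)" .
  have S: "?S \<in> (\<Pi>\<^sub>M k\<in>{Suc n..}. borel) \<rightarrow>\<^sub>M (\<Pi>\<^sub>M k\<in>{1..}. borel)"
    by (intro measurable_restrict measurable_component_singleton) auto
  have "later_waits n = ?S \<circ> (\<lambda>\<omega>. \<lambda>k\<in>{Suc n..}. e k \<omega>)"
    by (auto simp: later_waits_def fun_eq_iff)
  hence "distr M (\<Pi>\<^sub>M k\<in>{1..}. borel) (later_waits n)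
     = distr (distr M (\<Pi>\<^sub>M k\<in>{Suc n..}. borel) (\<lambda>\<omega>. \<lambda>k\<in>{Suc n..}. e k \<omega>)) (\<Pi>\<^sub>M k\<in>{1..}. borel) ?S"
    by (subst distr_distr[OF S]) (auto intro!: measurable_restrict measurable_e)
  also have "\<dots> = distr (\<Pi>\<^sub>M k\<in>{Suc n..}. exp_law) (\<Pi>\<^sub>M k\<in>{1..}. exp_law) ?S"
    unfolding tail by (intro distr_cong sets_PiM_cong) auto
  also have "\<dots> = waiting_law"
    unfolding waiting_law_def
    by (rule distr_PiM_reindex[where M="\<lambda>_. exp_law" and f="(+) n"]) (auto simp: prob_space_exp_law)
  finally show ?thesis .
qed

text \<open>
  Disjoint blocks of an independent family are independent; the second block is then renumbered
  from 1.
\<close>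
lemma distr_first_later_waits:
  "distr M ((\<Pi>\<^sub>M k\<in>{1..n}. borel) \<Otimes>\<^sub>M (\<Pi>\<^sub>M k\<in>{1..}. borel)) (\<lambda>\<omega>. (first_waits n \<omega>, later_waits n \<omega>))
     = distr M (\<Pi>\<^sub>M k\<in>{1..n}. borel) (first_waits n) \<Otimes>\<^sub>M waiting_law"
proof -
  let ?S = "\<lambda>w. \<lambda>k\<in>{1::nat..}. w (n + k) :: real"
  have S: "?S \<in> (\<Pi>\<^sub>M k\<in>{Suc n..}. borel) \<rightarrow>\<^sub>M (\<Pi>\<^sub>M k\<in>{1..}. borel)"
    by (intro measurable_restrict measurable_component_singleton) auto
  have "indep_var (\<Pi>\<^sub>M k\<in>{1..n}. borel) (\<lambda>\<omega>. \<lambda>k\<in>{1..n}. e k \<omega>)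
                  (\<Pi>\<^sub>M k\<in>{Suc n..}. borel) (\<lambda>\<omega>. \<lambda>k\<in>{Suc n..}. e k \<omega>)"
    by (rule indep_var_restrict[OF indep]) auto
  from indep_var_compose[OF this measurable_ident S]
  have "indep_var (\<Pi>\<^sub>M k\<in>{1..n}. borel) (first_waits n) (\<Pi>\<^sub>M k\<in>{1..}. borel) (later_waits n)"
    by (rule back_subst[where P="\<lambda>f. f", OF _ arg_cong2[where f="\<lambda>x y. indep_var _ x _ y"]])
       (auto simp: later_waits_def first_waits_def fun_eq_iff)
  thus ?thesis
    unfolding indep_var_distribution_eq distr_later_waits by simp
qed

text \<open>
  The lack of memory at a random threshold \<open>d\<close> that is a function of the first \<open>n\<close> waiting
  times: on the event that \<open>d\<close> is nonnegative and smaller than waiting time \<open>n + 1\<close>, the residual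
  sequence has law \<^const>\<open>waiting_law\<close> and is independent of the first \<open>n\<close> waiting times.
  By independence the threshold may be frozen, and
  \<open>nn_integral_waiting_law_memoryless\<close> applies.
\<close>
lemma memoryless_restart:
  assumes [measurable]: "d \<in> borel_measurable (\<Pi>\<^sub>M k\<in>{1..n}. borel)"
    "case_prod h \<in> borel_measurable ((\<Pi>\<^sub>M k\<in>{1..n}. borel) \<Otimes>\<^sub>M (\<Pi>\<^sub>M k\<in>{1..}. borel))"
  defines "U \<equiv> first_waits n" and "R \<equiv> later_waits n"
  shows "(\<integral>\<^sup>+\<omega>. indicator {0..<R \<omega> 1} (d (U \<omega>)) * h (U \<omega>) ((R \<omega>)(1 := R \<omega> 1 - d (U \<omega>))) \<partial>M)
       = (\<integral>\<^sup>+\<omega>. indicator {0..<R \<omega> 1} (d (U \<omega>)) * (\<integral>\<^sup>+w. h (U \<omega>) w \<partial>waiting_law) \<partial>M)"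
proof -
  let ?F = "\<Pi>\<^sub>M k\<in>{1..n}. (borel :: real measure)" and ?L = "\<Pi>\<^sub>M k\<in>{1::nat..}. (borel :: real measure)"
  let ?D = "distr M ?F U"
  interpret W: prob_space waiting_law by (rule prob_space_waiting_law)
  have [measurable]: "U \<in> M \<rightarrow>\<^sub>M ?F" "R \<in> M \<rightarrow>\<^sub>M ?L" by (auto simp: U_def R_def)
  have joint: "distr M (?F \<Otimes>\<^sub>M ?L) (\<lambda>\<omega>. (U \<omega>, R \<omega>)) = ?D \<Otimes>\<^sub>M waiting_law"
    using distr_first_later_waits by (simp add: U_def R_def)
  have law: "(\<integral>\<^sup>+\<omega>. f (U \<omega>) (R \<omega>) \<partial>M) = (\<integral>\<^sup>+u. \<integral>\<^sup>+w. f u w \<partial>waiting_law \<partial>?D)"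
    if [measurable]: "case_prod f \<in> borel_measurable (?F \<Otimes>\<^sub>M ?L)" for f :: "_ \<Rightarrow> _ \<Rightarrow> ennreal"
  proof -
    have "(\<integral>\<^sup>+\<omega>. f (U \<omega>) (R \<omega>) \<partial>M) = (\<integral>\<^sup>+x. case_prod f x \<partial>distr M (?F \<Otimes>\<^sub>M ?L) (\<lambda>\<omega>. (U \<omega>, R \<omega>)))"
      by (subst nn_integral_distr) auto
    also have "\<dots> = (\<integral>\<^sup>+u. \<integral>\<^sup>+w. f u w \<partial>waiting_law \<partial>?D)"
    proof -
      have "case_prod f \<in> borel_measurable (?D \<Otimes>\<^sub>M waiting_law)"
        using that by (simp add: measurable_cong_sets[OF sets_pair_measure_cong[OF sets_distr sets_waiting_law]])
      thus ?thesis unfolding joint by (subst W.nn_integral_fst[symmetric]) auto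
    qed
    finally show ?thesis .
  qed
  have upd: "(\<lambda>x. (snd x)(1 := snd x 1 - d (fst x))) \<in> ?F \<Otimes>\<^sub>M ?L \<rightarrow>\<^sub>M ?L"
    by (rule measurable_fun_upd[where J="{1..}"]) auto
  have [measurable]: "(\<lambda>x. h (fst x) ((snd x)(1 := snd x 1 - d (fst x)))) \<in> borel_measurable (?F \<Otimes>\<^sub>M ?L)"
    using measurable_compose[OF measurable_Pair[OF measurable_fst upd] assms(2)] by simp
  have [measurable]: "(\<lambda>u. \<integral>\<^sup>+w. h u w \<partial>waiting_law) \<in> borel_measurable ?F"
    by (rule W.borel_measurable_nn_integral)
       (simp add: measurable_cong_sets[OF sets_pair_measure_cong[OF refl sets_waiting_law]])
  have "(\<integral>\<^sup>+w. indicator {0..<w 1} (d u) * h u (w(1 := w 1 - d u)) \<partial>waiting_law)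
      = (\<integral>\<^sup>+w. indicator {0..<w 1} (d u) * (\<integral>\<^sup>+w. h u w \<partial>waiting_law) \<partial>waiting_law)"
    if "u \<in> space ?F" for u
  proof (cases "0 \<le> d u")
    case True
    have "indicator {0..<w 1} (d u) = (indicator {d u<..} (w 1) :: ennreal)" for w :: "nat \<Rightarrow> real"
      using True by (auto simp: indicator_def)
    moreover have "h u \<in> borel_measurable ?L"
      using measurable_compose[OF measurable_Pair1'[OF that] assms(2)] by simp
    ultimately show ?thesis
      using nn_integral_waiting_law_memoryless[OF _ True] by simp
  qed simp
  hence inner: "(\<integral>\<^sup>+u. \<integral>\<^sup>+w. indicator {0..<w 1} (d u) * h u (w(1 := w 1 - d u)) \<partial>waiting_law \<partial>?D)
      = (\<integral>\<^sup>+u. \<integral>\<^sup>+w. indicator {0..<w 1} (d u) * (\<integral>\<^sup>+w. h u w \<partial>waiting_law) \<partial>waiting_law \<partial>?D)"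
    by (intro nn_integral_cong[of ?D]) (simp add: U_def)
  have [measurable]: "(\<lambda>x. indicator {0..<snd x 1} (d (fst x)) :: ennreal) \<in> borel_measurable (?F \<Otimes>\<^sub>M ?L)"
    by (rule borel_measurable_indicator') (simp only: atLeastLessThan_iff, measurable)
  show ?thesis
    using inner by (subst (1 2) law) (simp_all add: case_prod_beta)
qed

end

context exponential_waiting begin

lemma AE_waits_positive: "AE \<omega> in M. \<forall>k\<ge>1. 0 < e k \<omega>"
proof -
  have "AE \<omega> in M. 0 < e k \<omega>" if "1 \<le> k" for k
  proof -
    have "prob {\<omega> \<in> space M. 0 < e k \<omega>} = 1"
      using exponential_distributedD_gt[OF exp_distributed[OF that], of 0] by simp
    from AE_prob_1[OF this] show ?thesis by simp
  qed
  thus ?thesis by (simp add: AE_all_countable)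
qed

text \<open>
  The first \<open>n\<close> waiting times are all at most \<open>C\<close> with probability \<open>p ^ n\<close>, where \<open>p < 1\<close>.
\<close>
lemma AE_waits_unbounded:
  assumes "0 \<le> C"
  shows "AE \<omega> in M. \<exists>k\<ge>1. C < e k \<omega>"
proof -
  define p where "p = 1 - exp (- C)"
  define Z where "Z = (\<Inter>k\<in>{1..}. e k -` {..C} \<inter> space M)"
  have p: "prob (e k -` {..C} \<inter> space M) = p" if "1 \<le> k" for k
  proof -
    have "e k -` {..C} \<inter> space M = {\<omega> \<in> space M. e k \<omega> \<le> C}" by auto
    thus ?thesis using exponential_distributedD_le[OF exp_distributed[OF that] assms]
      by (simp add: p_def)
  qed
  have Z [measurable]: "Z \<in> events"
    unfolding Z_def using measurable_e by (intro sets.countable_INT' measurable_sets) auto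
  have "prob Z \<le> p ^ n" if "1 \<le> n" for n
  proof -
    have "prob Z \<le> prob (\<Inter>k\<in>{1..n}. e k -` {..C} \<inter> space M)"
      using that measurable_e
      by (intro finite_measure_mono sets.finite_INT measurable_sets) (auto simp: Z_def)
    also have "\<dots> = (\<Prod>k\<in>{1..n}. prob (e k -` {..C} \<inter> space M))"
      using that by (intro indep_varsD[OF indep]) auto
    also have "\<dots> = p ^ n" using p by simp
    finally show ?thesis .
  qed
  hence ev: "\<forall>\<^sub>F n in sequentially. prob Z \<le> p ^ n"
    unfolding eventually_sequentially by blast
  have "(\<lambda>n. p ^ n) \<longlonglongrightarrow> 0"
    using assms by (intro LIMSEQ_realpow_zero) (auto simp: p_def)
  hence "prob Z \<le> 0" using ev by (intro tendsto_lowerbound) auto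
  hence "Z \<in> null_sets M"
    using Z measure_nonneg[of M Z] by (auto intro!: null_setsI simp: emeasure_eq_measure)
  thus ?thesis
    by (rule AE_I'[of Z]) (auto simp: Z_def not_less)
qed

text \<open>
  A single waiting time already exceeds any given bound at some index, and all
  jump times are sums of nonnegative terms; hence the jump times are unbounded.
\<close>
lemma AE_regular:
  assumes "0 < a" "0 < b"
  shows "AE \<omega> in M. regular a b (\<lambda>k. e k \<omega>)"
proof -
  define c where "c = min (1 / a) (1 / b)"
  have c: "0 < c" "\<And>k. c \<le> jump_scale a b k"
    using assms by (auto simp: c_def jump_scale_def)
  have "AE \<omega> in M. \<forall>m::nat. \<exists>k\<ge>1. real m / c < e k \<omega>"
    using c(1) by (intro AE_all_countable[THEN iffD2] allI AE_waits_unbounded) auto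
  with AE_waits_positive show ?thesis
  proof eventually_elim
    case (elim \<omega>)
    let ?w = "\<lambda>k. e k \<omega>"
    have "\<exists>k. t < jump_time a b ?w k" for t
    proof -
      obtain m :: nat where m: "t \<le> real m" using real_arch_simple by blast
      obtain k where k: "1 \<le> k" "real m / c < e k \<omega>" using elim(2) by blast
      have "t < c * e k \<omega>" using m k(2) c(1) by (simp add: field_simps)
      also have "\<dots> \<le> jump_scale a b k * e k \<omega>"
        using c(2) elim(1) k(1) by (intro mult_right_mono) (auto intro: less_imp_le)
      also have "\<dots> \<le> jump_time a b ?w k"
        unfolding jump_time_def using k(1) elim(1) jump_scale_pos[OF assms]
        by (intro member_le_sum[where f="\<lambda>i. jump_scale a b i * e i \<omega>"])
           (auto intro!: mult_nonneg_nonneg intro: less_imp_le)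
      finally show ?thesis by blast
    qed
    thus ?case using elim(1) by (auto simp: regular_def)
  qed
qed

end

section \<open>The restarted process\<close>

text \<open>
  The path that continues from the state \<open>(x, n)\<close> with fresh waiting times \<open>w\<close>.  Its law under
  \<^const>\<open>waiting_law\<close>, as a function of the state, is the transition kernel on path space.
\<close>
definition restart :: "real \<Rightarrow> real \<Rightarrow> real \<times> nat \<Rightarrow> (nat \<Rightarrow> real) \<Rightarrow> real \<Rightarrow> real \<times> nat" where
  "restart a b = (\<lambda>(x, n) w. \<lambda>t\<in>{0..}.
     if even n then (x + Z_path a b t w, n + N_path a b t w)
     else (x - Z_path b a t w, n + N_path b a t w))"

lemma measurable_N_path [measurable]: "N_path a b t \<in> (\<Pi>\<^sub>M k\<in>{1..}. borel) \<rightarrow>\<^sub>M count_space UNIV"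
proof (rule measurable_N_proc_compose[where f="\<lambda>_. t" and g="\<lambda>w. w"])
  show "(\<lambda>w. w k) \<in> borel_measurable (\<Pi>\<^sub>M k\<in>{1..}. borel)" if "1 \<le> k" for k :: nat
    using that by (intro measurable_component_singleton) auto
qed auto

lemma measurable_Z_path [measurable]: "Z_path a b t \<in> borel_measurable (\<Pi>\<^sub>M k\<in>{1..}. borel)"
proof (rule measurable_Z_proc)
  show "(\<lambda>w. w k) \<in> borel_measurable (\<Pi>\<^sub>M k\<in>{1..}. borel)" if "1 \<le> k" for k :: nat
    using that by (intro measurable_component_singleton) auto
qed

lemma measurable_restart [measurable]:
  "(\<lambda>(y, w). restart a b y w) \<in> state_space \<Otimes>\<^sub>M waiting_law \<rightarrow>\<^sub>M path_space"
proof -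
  have "(\<lambda>p. if even (snd (fst p)) then (fst (fst p) + Z_path a b t (snd p), snd (fst p) + N_path a b t (snd p))
     else (fst (fst p) - Z_path b a t (snd p), snd (fst p) + N_path b a t (snd p)))
      \<in> state_space \<Otimes>\<^sub>M waiting_law \<rightarrow>\<^sub>M state_space" for t
    by measurable
  thus ?thesis
    unfolding restart_def case_prod_beta by (intro measurable_restrict)
qed

lemma measurable_restart_law:
  "(\<lambda>y. distr waiting_law path_space (restart a b y)) \<in> state_space \<rightarrow>\<^sub>M prob_algebra path_space"
proof (rule measurable_distr_prob_space2)
  show "(\<lambda>_. waiting_law) \<in> state_space \<rightarrow>\<^sub>M prob_algebra waiting_law"
    by (rule measurable_const) (simp add: space_prob_algebra prob_space_waiting_law)
qed measurable

text \<open>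
  This puts the event of exactly \<open>n\<close> jumps into the form required by \<open>memoryless_restart\<close>: the threshold is
  a function of the first \<open>n\<close> waiting times, and \<open>jump_time a b w n \<le> s\<close> says that it is nonnegative.
\<close>
lemma between_jumps_residual_iff:
  assumes "0 < a" "0 < b"
  shows "between_jumps a b s w n \<longleftrightarrow>
    (s - jump_time a b w n) / jump_scale a b (Suc n) \<in> {0..<w (Suc n)}"
  using jump_scale_pos[OF assms, of "Suc n"]
  by (auto simp: between_jumps_def jump_time_Suc field_simps)

lemma restart_residual:
  assumes "0 < a" "0 < b" "regular a b w" "between_jumps a b s w n" "0 \<le> s"
  shows "restart a b (Z_path a b s w, n) (residual a b s n w)
    = (\<lambda>t\<in>{0..}. (Z_path a b (t + s) w, N_path a b (t + s) w))"
  using N_path_shift[OF assms(1-4)] Z_path_shift[OF assms]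
  by (auto simp: restart_def fun_eq_iff restrict_def)

section \<open>The future given the past\<close>

lemma measurable_freeze: "freeze a b s n \<in> (\<Pi>\<^sub>M k\<in>{1..n}. borel) \<rightarrow>\<^sub>M (\<Pi>\<^sub>M k\<in>UNIV. borel)"
  unfolding freeze_def
proof (rule measurable_PiM_single')
  show "(\<lambda>u. if k \<in> {1..n} then u k else (s + 1) / jump_scale a b k) \<in> borel_measurable (\<Pi>\<^sub>M k\<in>{1..n}. borel)"
    for k
    by (cases "k \<in> {1..n}") (auto intro: measurable_component_singleton)
qed (auto simp: space_PiM)

lemma measurable_N_path_freeze:
  "(\<lambda>v. N_path a b u (freeze a b s n v)) \<in> (\<Pi>\<^sub>M k\<in>{1..n}. borel) \<rightarrow>\<^sub>M count_space UNIV"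
proof (rule measurable_N_proc_compose[where f="\<lambda>_. u", OF _ _ measurable_freeze])
  show "(\<lambda>w. w k) \<in> borel_measurable (\<Pi>\<^sub>M k\<in>UNIV. borel)" for k :: nat
    by (rule measurable_component_singleton) auto
qed auto

lemma measurable_Z_path_freeze:
  "(\<lambda>v. Z_path a b u (freeze a b s n v)) \<in> borel_measurable (\<Pi>\<^sub>M k\<in>{1..n}. borel)"
proof (rule measurable_compose[OF measurable_freeze measurable_Z_proc])
  show "(\<lambda>w. w k) \<in> borel_measurable (\<Pi>\<^sub>M k\<in>UNIV. borel)" for k :: nat
    by (rule measurable_component_singleton) auto
qed

lemma measurable_jump_time:
  "(\<lambda>u. jump_time a b u n) \<in> borel_measurable (\<Pi>\<^sub>M k\<in>{1..n}. borel)"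
  unfolding jump_time_def
  by (intro borel_measurable_sum borel_measurable_times borel_measurable_const measurable_component_singleton)

locale alternating_process = exponential_waiting M e for M :: "'a measure" and e +
  fixes a b :: real
  assumes a: "0 < a" and b: "0 < b"
begin

definition state :: "real \<Rightarrow> 'a \<Rightarrow> real \<times> nat" where
  "state t \<omega> = (Z_proc e a b t \<omega>, N_proc e a b t \<omega>)"

definition future :: "real \<Rightarrow> 'a \<Rightarrow> real \<Rightarrow> real \<times> nat" where
  "future s \<omega> = (\<lambda>t\<in>{0..}. state (t + s) \<omega>)"

lemma measurable_state [measurable]: "state t \<in> M \<rightarrow>\<^sub>M state_space"
proof -
  have "N_proc e a b t \<in> M \<rightarrow>\<^sub>M count_space UNIV"
    by (rule measurable_N_proc_compose[where f="\<lambda>_. t" and g="\<lambda>\<omega>. \<omega>" and M=M, OF measurable_e]) auto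
  moreover have "Z_proc e a b t \<in> borel_measurable M"
    by (rule measurable_Z_proc) (rule measurable_e)
  ultimately show ?thesis
    unfolding state_def by (intro measurable_Pair)
qed

lemma measurable_future [measurable]: "future s \<in> M \<rightarrow>\<^sub>M path_space"
  unfolding future_def by (intro measurable_restrict measurable_state)

lemma state_path:
  assumes "\<And>k. 1 \<le> k \<Longrightarrow> w k = e k \<omega>"
  shows "state t \<omega> = (Z_path a b t w, N_path a b t w)"
  using N_proc_path[of w e \<omega>, OF assms] Z_proc_path[of w e \<omega>, OF assms] by (simp add: state_def)

lemma sets_natural_filtration:
  "sets (natural_filtration M state_space state s)
     = sigma_sets (space M) {state u -` A \<inter> space M | u A. 0 \<le> u \<and> u \<le> s \<and> A \<in> sets state_space}"
  unfolding natural_filtration_def by (rule sets_measure_of) auto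

lemma subalgebra_natural_filtration: "subalgebra M (natural_filtration M state_space state s)"
proof -
  have "space (natural_filtration M state_space state s) = space M"
    unfolding natural_filtration_def by (rule space_measure_of) auto
  thus ?thesis
    unfolding subalgebra_def sets_natural_filtration
    by (auto intro!: sets.sigma_sets_subset measurable_sets[OF measurable_state])
qed

text \<open>
  When the waiting times are positive and \<open>n\<close> jumps occur by time \<open>s\<close>, no event of the past distinguishes sample points
  with the same first \<open>n\<close> waiting times.  For the generators this is seen by freezing the
  later waiting times, and the property passes to complements and countable unions.
\<close>
lemma past_event_first_waits:
  assumes "0 \<le> s" "B \<in> sets (natural_filtration M state_space state s)"
  shows "\<exists>C\<in>sets (\<Pi>\<^sub>M k\<in>{1..n}. borel). \<forall>\<omega>\<in>space M.
    (\<forall>k\<ge>1. 0 < e k \<omega>) \<longrightarrow> between_jumps a b s (\<lambda>k. e k \<omega>) n \<longrightarrow> (\<omega> \<in> B \<longleftrightarrow> first_waits n \<omega> \<in> C)"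
    (is "\<exists>C\<in>sets ?F. ?P B C")
  using assms(2) unfolding sets_natural_filtration
proof (induction rule: sigma_sets.induct)
  case (Basic B)
  then obtain u A where u: "0 \<le> u" "u \<le> s" and A: "A \<in> sets state_space"
    and B: "B = state u -` A \<inter> space M" by auto
  let ?g = "\<lambda>v. (Z_path a b u (freeze a b s n v), N_path a b u (freeze a b s n v))"
  have "?g \<in> ?F \<rightarrow>\<^sub>M state_space"
    by (intro measurable_Pair measurable_Z_path_freeze measurable_N_path_freeze)
  hence C: "?g -` A \<inter> space ?F \<in> sets ?F" using A by (rule measurable_sets)
  have "?P B (?g -` A \<inter> space ?F)"
  proof (intro ballI impI)
    fix \<omega> assume \<omega>: "\<omega> \<in> space M" and pos: "\<forall>k\<ge>1. 0 < e k \<omega>"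
      and ren: "between_jumps a b s (\<lambda>k. e k \<omega>) n"
    have fw: "first_waits n \<omega> k = e k \<omega>" if "k \<in> {1..n}" for k
      using that by (simp add: first_waits_def)
    have "?g (first_waits n \<omega>) = state u \<omega>"
      using N_path_freeze[OF a b assms(1) _ ren u(2) fw] Z_path_freeze[OF a b assms(1) _ ren u(2) fw]
        pos state_path[of "\<lambda>k. e k \<omega>" \<omega> u] by simp
    moreover have "first_waits n \<omega> \<in> space ?F"
      using \<omega> by (rule measurable_space[OF measurable_first_waits])
    ultimately show "\<omega> \<in> B \<longleftrightarrow> first_waits n \<omega> \<in> ?g -` A \<inter> space ?F"
      using \<omega> by (simp add: B)
  qed
  with C show ?case by blast
next
  case Empty
  show ?case by (rule bexI[of _ "{}"]) auto
next
  case (Compl B)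
  then obtain C where C: "C \<in> sets ?F" "?P B C" by blast
  have "first_waits n \<omega> \<in> space ?F" if "\<omega> \<in> space M" for \<omega>
    using that by (rule measurable_space[OF measurable_first_waits])
  hence "?P (space M - B) (space ?F - C)" using C(2) by auto
  with C(1) show ?case by blast
next
  case (Union B)
  from Union.IH have "\<forall>i. \<exists>C. C \<in> sets ?F \<and> ?P (B i) C" unfolding Bex_def by (rule allI)
  from choice[OF this] obtain C where C: "\<forall>i. C i \<in> sets ?F \<and> ?P (B i) (C i)" by (elim exE)
  have "(\<Union>i. C i) \<in> sets ?F" using C by auto
  moreover have "?P (\<Union>i. B i) (\<Union>i. C i)"
  proof (intro ballI impI)
    fix \<omega> assume "\<omega> \<in> space M" "\<forall>k\<ge>1. 0 < e k \<omega>" "between_jumps a b s (\<lambda>k. e k \<omega>) n"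
    hence "\<omega> \<in> B i \<longleftrightarrow> first_waits n \<omega> \<in> C i" for i using C by simp
    thus "\<omega> \<in> (\<Union>i. B i) \<longleftrightarrow> first_waits n \<omega> \<in> (\<Union>i. C i)" by simp
  qed
  ultimately show ?case by blast
qed

lemma residual_later_waits:
  "residual a b s n (\<lambda>k. e k \<omega>) = (later_waits n \<omega>)(1 := later_waits n \<omega> 1
     - (s - jump_time a b (first_waits n \<omega>) n) / jump_scale a b (Suc n))"
proof -
  have "jump_time a b (first_waits n \<omega>) n = jump_time a b (\<lambda>k. e k \<omega>) n"
    by (rule jump_time_cong) (simp add: first_waits_def)
  thus ?thesis by (simp add: residual_def later_waits_def Suc_eq_plus1)
qed

text \<open>
  The law of the future after \<open>s\<close> on an event of the past.  Both integrands are decomposed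
  according to the number \<open>n\<close> of jumps by time \<open>s\<close>, and \<open>memoryless_restart\<close> is applied to
  each term.
\<close>
lemma nn_integral_future:
  assumes "0 \<le> s" and B: "B \<in> sets (natural_filtration M state_space state s)"
    and H [measurable]: "H \<in> borel_measurable path_space"
  shows "(\<integral>\<^sup>+\<omega>. indicator B \<omega> * H (future s \<omega>) \<partial>M)
    = (\<integral>\<^sup>+\<omega>. indicator B \<omega> * (\<integral>\<^sup>+w. H (restart a b (state s \<omega>) w) \<partial>waiting_law) \<partial>M)"
proof -
  interpret W: prob_space waiting_law by (rule prob_space_waiting_law)
  let ?F = "\<lambda>n. \<Pi>\<^sub>M k\<in>{1..n}. (borel :: real measure)" and ?L = "\<Pi>\<^sub>M k\<in>{1::nat..}. (borel :: real measure)"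
  obtain C where C [measurable]: "\<And>n. C n \<in> sets (?F n)"
    and BC: "\<And>n \<omega>. \<omega> \<in> space M \<Longrightarrow> (\<forall>k\<ge>1. 0 < e k \<omega>) \<Longrightarrow> between_jumps a b s (\<lambda>k. e k \<omega>) n
      \<Longrightarrow> \<omega> \<in> B \<longleftrightarrow> first_waits n \<omega> \<in> C n"
    using past_event_first_waits[OF assms(1) B] by metis
  \<comment> \<open>\<open>d\<close> is the threshold, \<open>z\<close> the value of the integral at time \<open>s\<close>, \<open>D n\<close> the indicator of exactly
    \<open>n\<close> jumps; \<open>l n\<close> and \<open>r n\<close> are the contributions of \<open>D n\<close> to the two sides.\<close>
  define d where "d n u = (s - jump_time a b u n) / jump_scale a b (Suc n)" for n u
  define z where "z n u = Z_path a b s (freeze a b s n u)" for n u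
  define h where "h n u w = indicator (C n) u * H (restart a b (z n u, n) w)" for n u w
  define D where "D n \<omega> = (indicator {0..<later_waits n \<omega> 1} (d n (first_waits n \<omega>)) :: ennreal)" for n \<omega>
  define l where "l n \<omega> = D n \<omega> * h n (first_waits n \<omega>)
    ((later_waits n \<omega>)(1 := later_waits n \<omega> 1 - d n (first_waits n \<omega>)))" for n \<omega>
  define r where "r n \<omega> = D n \<omega> * (\<integral>\<^sup>+w. h n (first_waits n \<omega>) w \<partial>waiting_law)" for n \<omega>

  have d [measurable]: "d n \<in> borel_measurable (?F n)" for n
    unfolding d_def using measurable_jump_time by measurable
  have z [measurable]: "z n \<in> borel_measurable (?F n)" for n
    unfolding z_def by (rule measurable_Z_path_freeze)
  have "(\<lambda>p. restart a b (z n (fst p), n) (snd p)) \<in> ?F n \<Otimes>\<^sub>M ?L \<rightarrow>\<^sub>M path_space" for n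
  proof -
    have "(\<lambda>p. ((z n (fst p), n), snd p)) \<in> ?F n \<Otimes>\<^sub>M ?L \<rightarrow>\<^sub>M state_space \<Otimes>\<^sub>M waiting_law" by measurable
    from measurable_compose[OF this measurable_restart] show ?thesis by simp
  qed
  note [measurable] = this
  have h [measurable]: "case_prod (h n) \<in> borel_measurable (?F n \<Otimes>\<^sub>M ?L)" for n
    unfolding h_def case_prod_beta by measurable
  have D [measurable]: "D n \<in> borel_measurable M" for n
    unfolding D_def by (rule borel_measurable_indicator') (simp only: atLeastLessThan_iff, measurable)
  have l [measurable]: "l n \<in> borel_measurable M" for n
  proof -
    have "(\<lambda>\<omega>. (later_waits n \<omega>)(1 := later_waits n \<omega> 1 - d n (first_waits n \<omega>))) \<in> M \<rightarrow>\<^sub>M ?L"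
      by (rule measurable_fun_upd[where J="{1..}"]) auto
    from measurable_compose[OF measurable_Pair[OF measurable_first_waits this] h]
    have [measurable]: "(\<lambda>\<omega>. h n (first_waits n \<omega>)
      ((later_waits n \<omega>)(1 := later_waits n \<omega> 1 - d n (first_waits n \<omega>)))) \<in> borel_measurable M" by simp
    show ?thesis unfolding l_def by measurable
  qed
  have r [measurable]: "r n \<in> borel_measurable M" for n
  proof -
    have [measurable]: "(\<lambda>u. \<integral>\<^sup>+w. h n u w \<partial>waiting_law) \<in> borel_measurable (?F n)"
      by (rule W.borel_measurable_nn_integral)
         (simp add: measurable_cong_sets[OF sets_pair_measure_cong[OF refl sets_waiting_law]])
    show ?thesis unfolding r_def by measurable
  qed

  have split: "indicator B \<omega> * H (future s \<omega>) = (\<Sum>n. l n \<omega>)"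
    "indicator B \<omega> * (\<integral>\<^sup>+w. H (restart a b (state s \<omega>) w) \<partial>waiting_law) = (\<Sum>n. r n \<omega>)"
    if \<omega>: "\<omega> \<in> space M" and reg: "regular a b (\<lambda>k. e k \<omega>)" for \<omega>
  proof -
    let ?w = "\<lambda>k. e k \<omega>"
    note mono = regular_strict_mono[OF a b reg]
    have pos: "\<forall>k\<ge>1. 0 < e k \<omega>" using reg by (auto simp: regular_def)
    have D_eq: "D n \<omega> = indicator {n. between_jumps a b s ?w n} n" for n
    proof -
      have "jump_time a b (first_waits n \<omega>) n = jump_time a b ?w n"
        by (rule jump_time_cong) (simp add: first_waits_def)
      thus ?thesis
        using between_jumps_residual_iff[OF a b, of s ?w n]
        by (simp add: D_def d_def later_waits_def indicator_def Suc_eq_plus1)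
    qed
    obtain n where n: "between_jumps a b s ?w n" using between_jumps_exists[OF reg assms(1)] by blast
    have D0: "D m \<omega> = 0" if "m \<noteq> n" for m
      using between_jumps_unique[OF mono n] that by (auto simp: D_eq indicator_def)
    have D1: "D n \<omega> = 1" using n by (simp add: D_eq)
    have "z n (first_waits n \<omega>) = Z_path a b s ?w"
      unfolding z_def using pos
      by (intro Z_path_freeze[OF a b assms(1) _ n]) (auto simp: first_waits_def)
    moreover have Xt: "state t \<omega> = (Z_path a b t ?w, N_path a b t ?w)" for t
      by (rule state_path) simp
    ultimately have Xs: "state s \<omega> = (z n (first_waits n \<omega>), n)"
      using N_path_renewal_at[OF mono n] by simp
    have fut: "future s \<omega> = restart a b (state s \<omega>)
        ((later_waits n \<omega>)(1 := later_waits n \<omega> 1 - d n (first_waits n \<omega>)))"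
      using restart_residual[OF a b reg n assms(1)] N_path_renewal_at[OF mono n]
      by (simp add: future_def Xt residual_later_waits d_def)
    have ind: "indicator (C n) (first_waits n \<omega>) = (indicator B \<omega> :: ennreal)"
      using BC[OF \<omega> pos n] by (simp add: indicator_def)
    have "(\<Sum>n. l n \<omega>) = l n \<omega>"
      using suminf_finite[of "{n}" "\<lambda>n. l n \<omega>"] D0 by (simp add: l_def)
    thus "indicator B \<omega> * H (future s \<omega>) = (\<Sum>n. l n \<omega>)"
      by (simp add: l_def D1 h_def ind fut Xs)
    have "(\<Sum>n. r n \<omega>) = r n \<omega>"
      using suminf_finite[of "{n}" "\<lambda>n. r n \<omega>"] D0 by (simp add: r_def)
    thus "indicator B \<omega> * (\<integral>\<^sup>+w. H (restart a b (state s \<omega>) w) \<partial>waiting_law) = (\<Sum>n. r n \<omega>)"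
      by (cases "\<omega> \<in> B") (simp_all add: r_def D1 h_def ind Xs)
  qed
  have "(\<integral>\<^sup>+\<omega>. indicator B \<omega> * H (future s \<omega>) \<partial>M) = (\<integral>\<^sup>+\<omega>. (\<Sum>n. l n \<omega>) \<partial>M)"
    using AE_regular[OF a b] by (intro nn_integral_cong_AE) (auto simp: split)
  also have "\<dots> = (\<Sum>n. \<integral>\<^sup>+\<omega>. l n \<omega> \<partial>M)" by (rule nn_integral_suminf) measurable
  also have "\<dots> = (\<Sum>n. \<integral>\<^sup>+\<omega>. r n \<omega> \<partial>M)"
    unfolding l_def r_def D_def by (intro suminf_cong memoryless_restart) auto
  also have "\<dots> = (\<integral>\<^sup>+\<omega>. (\<Sum>n. r n \<omega>) \<partial>M)" by (rule nn_integral_suminf[symmetric]) measurable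
  also have "\<dots> = (\<integral>\<^sup>+\<omega>. indicator B \<omega> * (\<integral>\<^sup>+w. H (restart a b (state s \<omega>) w) \<partial>waiting_law) \<partial>M)"
    using AE_regular[OF a b] by (intro nn_integral_cong_AE) (auto simp: split)
  finally show ?thesis .
qed

end

section \<open>Conditional expectations and the Markov property\<close>

lemma measurable_restart_fixed: "restart a b y \<in> waiting_law \<rightarrow>\<^sub>M path_space"
  using measurable_compose[OF measurable_Pair1'[of y state_space waiting_law] measurable_restart[of a b]]
  by (simp add: space_pair_measure)

lemma abs_restart_le:
  fixes H :: "(real \<Rightarrow> real \<times> nat) \<Rightarrow> real"
  assumes "\<And>p. p \<in> space path_space \<Longrightarrow> \<bar>H p\<bar> \<le> c" "w \<in> space waiting_law"
  shows "\<bar>H (restart a b y w)\<bar> \<le> c"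
  using assms(2) by (intro assms(1) measurable_space[OF measurable_restart_fixed])

lemma integrable_restart:
  fixes H :: "(real \<Rightarrow> real \<times> nat) \<Rightarrow> real"
  assumes "H \<in> borel_measurable path_space" "\<And>p. p \<in> space path_space \<Longrightarrow> \<bar>H p\<bar> \<le> c"
  shows "integrable waiting_law (\<lambda>w. H (restart a b y w))"
proof -
  interpret W: prob_space waiting_law by (rule prob_space_waiting_law)
  show ?thesis
    using abs_restart_le[of H c, OF assms(2)] measurable_compose[OF measurable_restart_fixed assms(1)]
    by (intro W.integrable_const_bound[where B=c]) auto
qed

lemma abs_integral_restart_le:
  fixes H :: "(real \<Rightarrow> real \<times> nat) \<Rightarrow> real"
  assumes "H \<in> borel_measurable path_space" "\<And>p. p \<in> space path_space \<Longrightarrow> \<bar>H p\<bar> \<le> c"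
  shows "\<bar>\<integral>w. H (restart a b y w) \<partial>waiting_law\<bar> \<le> c"
proof -
  interpret W: prob_space waiting_law by (rule prob_space_waiting_law)
  have "\<bar>\<integral>w. H (restart a b y w) \<partial>waiting_law\<bar> \<le> (\<integral>w. \<bar>H (restart a b y w)\<bar> \<partial>waiting_law)"
    by (rule integral_abs_bound)
  also have "\<dots> \<le> (\<integral>w. c \<partial>waiting_law)"
    using integrable_restart[of H c, OF assms] abs_restart_le[of H c, OF assms(2)]
    by (intro integral_mono) auto
  finally show ?thesis by (simp add: W.prob_space)
qed

lemma measurable_integral_restart:
  fixes H :: "(real \<Rightarrow> real \<times> nat) \<Rightarrow> real"
  assumes "H \<in> borel_measurable path_space"
  shows "(\<lambda>y. \<integral>w. H (restart a b y w) \<partial>waiting_law) \<in> borel_measurable state_space"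
proof -
  interpret W: prob_space waiting_law by (rule prob_space_waiting_law)
  show ?thesis
    using measurable_compose[OF measurable_restart assms]
    by (intro W.borel_measurable_lebesgue_integral) (simp add: case_prod_beta)
qed

context alternating_process begin

text \<open>
  Bounded real functions reduce to nonnegative ones by adding the bound \<open>c\<close>.
\<close>
lemma set_integral_future:
  fixes H :: "(real \<Rightarrow> real \<times> nat) \<Rightarrow> real"
  assumes s: "0 \<le> s" and B: "B \<in> sets (natural_filtration M state_space state s)"
    and H [measurable]: "H \<in> borel_measurable path_space" and c: "\<And>p. p \<in> space path_space \<Longrightarrow> \<bar>H p\<bar> \<le> c"
  shows "(LINT \<omega>:B|M. H (future s \<omega>))
    = (LINT \<omega>:B|M. (\<integral>w. H (restart a b (state s \<omega>) w) \<partial>waiting_law))"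
proof -
  interpret W: prob_space waiting_law by (rule prob_space_waiting_law)
  define g where "g \<omega> = (\<integral>w. H (restart a b (state s \<omega>) w) \<partial>waiting_law)" for \<omega>
  have Bm [measurable]: "B \<in> events"
    using B subalgebra_natural_filtration[of s] by (auto simp: subalgebra_def)
  have H_future: "\<bar>H (future s \<omega>)\<bar> \<le> c" if "\<omega> \<in> space M" for \<omega>
    using that by (intro c measurable_space[OF measurable_future])
  note int_restart = integrable_restart[of H c a b, OF H c]
  have gm [measurable]: "g \<in> borel_measurable M"
    unfolding g_def by (rule measurable_compose[OF measurable_state measurable_integral_restart[OF H]])
  have g_bound: "\<bar>g \<omega>\<bar> \<le> c" for \<omega>
    unfolding g_def by (rule abs_integral_restart_le[OF H c])
  have shift: "(LINT \<omega>:B|M. f \<omega>) = enn2real (\<integral>\<^sup>+\<omega>. indicator B \<omega> * ennreal (f \<omega> + c) \<partial>M) - c * prob B"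
    if [measurable]: "f \<in> borel_measurable M" and f: "\<And>\<omega>. \<omega> \<in> space M \<Longrightarrow> \<bar>f \<omega>\<bar> \<le> c" for f
  proof -
    have "integrable M f"
      using f by (intro integrable_const_bound[where B=c]) auto
    from integrable_real_mult_indicator[OF Bm this]
    have int: "integrable M (\<lambda>\<omega>. indicator B \<omega> * f \<omega>)"
      by (simp add: mult.commute)
    have int': "integrable M (\<lambda>\<omega>. indicator B \<omega> * c)"
      using integrable_real_mult_indicator[OF Bm, of "\<lambda>_. c"] by (simp add: mult.commute)
    have "(LINT \<omega>:B|M. f \<omega>) + c * prob B = (\<integral>\<omega>. indicator B \<omega> * (f \<omega> + c) \<partial>M)"
      using Bochner_Integration.integral_add[OF int int']
      by (simp add: set_lebesgue_integral_def distrib_left mult.commute)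
    also have "\<dots> = enn2real (\<integral>\<^sup>+\<omega>. ennreal (indicator B \<omega> * (f \<omega> + c)) \<partial>M)"
    proof (rule integral_eq_nn_integral)
      show "AE \<omega> in M. 0 \<le> indicator B \<omega> * (f \<omega> + c)"
      proof (rule AE_I2)
        fix \<omega> assume "\<omega> \<in> space M"
        from f[OF this] show "0 \<le> indicator B \<omega> * (f \<omega> + c)" by (intro mult_nonneg_nonneg) auto
      qed
    qed measurable
    also have "(\<lambda>\<omega>. ennreal (indicator B \<omega> * (f \<omega> + c))) = (\<lambda>\<omega>. indicator B \<omega> * ennreal (f \<omega> + c))"
      by (auto simp: indicator_def)
    finally show ?thesis by simp
  qed
  have "(\<integral>\<^sup>+\<omega>. indicator B \<omega> * ennreal (H (future s \<omega>) + c) \<partial>M)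
      = (\<integral>\<^sup>+\<omega>. indicator B \<omega> * (\<integral>\<^sup>+w. ennreal (H (restart a b (state s \<omega>) w) + c) \<partial>waiting_law) \<partial>M)"
    using nn_integral_future[OF s B, of "\<lambda>p. ennreal (H p + c)"] by simp
  also have "\<dots> = (\<integral>\<^sup>+\<omega>. indicator B \<omega> * ennreal (g \<omega> + c) \<partial>M)"
  proof -
    have "(\<integral>\<^sup>+w. ennreal (H (restart a b y w) + c) \<partial>waiting_law)
        = ennreal ((\<integral>w. H (restart a b y w) \<partial>waiting_law) + c)" for y
    proof -
      have "0 \<le> H (restart a b y w) + c" if "w \<in> space waiting_law" for w
        using abs_restart_le[of H c w a b y, OF c that] by linarith
      hence "(\<integral>\<^sup>+w. ennreal (H (restart a b y w) + c) \<partial>waiting_law)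
          = ennreal (\<integral>w. H (restart a b y w) + c \<partial>waiting_law)"
        using int_restart by (intro nn_integral_eq_integral) auto
      thus ?thesis using int_restart[of y] by (simp add: W.prob_space)
    qed
    thus ?thesis by (simp add: g_def)
  qed
  finally have eq: "(\<integral>\<^sup>+\<omega>. indicator B \<omega> * ennreal (H (future s \<omega>) + c) \<partial>M)
      = (\<integral>\<^sup>+\<omega>. indicator B \<omega> * ennreal (g \<omega> + c) \<partial>M)" .
  have "(\<lambda>\<omega>. H (future s \<omega>)) \<in> borel_measurable M"
    by (rule measurable_compose[OF measurable_future H])
  from shift[OF this H_future] shift[OF gm g_bound] eq show ?thesis
    by (simp add: g_def)
qed

lemma vimage_subset_natural_filtration:
  assumes "0 \<le> s"
  shows "sets (vimage_algebra (space M) (state s) state_space) \<subseteq> sets (natural_filtration M state_space state s)"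
  unfolding sets_natural_filtration sets_vimage_algebra
  using assms by (intro sigma_sets_mono') blast

text \<open>
  The integral on the right depends on the state at time \<open>s\<close> only, hence is measurable already for the smallest
  sigma-algebra \<open>F\<close> admitted here; the averaging property holds already for the largest one.
\<close>
lemma cond_exp_future:
  fixes H :: "(real \<Rightarrow> real \<times> nat) \<Rightarrow> real"
  assumes s: "0 \<le> s" and F: "subalgebra M F" "sets F \<subseteq> sets (natural_filtration M state_space state s)"
    "sets (vimage_algebra (space M) (state s) state_space) \<subseteq> sets F"
    and H: "H \<in> borel_measurable path_space" "\<And>p. p \<in> space path_space \<Longrightarrow> \<bar>H p\<bar> \<le> c"
  shows "AE \<omega> in M. real_cond_exp M F (\<lambda>\<omega>. H (future s \<omega>)) \<omega>
    = (\<integral>w. H (restart a b (state s \<omega>) w) \<partial>waiting_law)"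
proof -
  interpret F: finite_measure_subalgebra M F by unfold_locales (rule F(1))
  let ?G = "\<lambda>y. \<integral>w. H (restart a b y w) \<partial>waiting_law"
  note G = measurable_integral_restart[OF H(1), of a b]
  note G_bound = abs_integral_restart_le[of H c a b, OF H]
  have "state s \<in> F \<rightarrow>\<^sub>M state_space"
    using measurable_vimage_algebra1[of "state s" "space M" state_space] F(1,3)
    by (auto simp: measurable_def subalgebra_def space_pair_measure)
  hence GX: "(\<lambda>\<omega>. ?G (state s \<omega>)) \<in> borel_measurable F" using G by (rule measurable_compose)
  show ?thesis
  proof (rule F.real_cond_exp_charact)
    show "(LINT \<omega>:B|M. H (future s \<omega>)) = (LINT \<omega>:B|M. ?G (state s \<omega>))" if "B \<in> sets F" for B
      using that F(2) by (intro set_integral_future[OF s _ H]) auto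
    show "integrable M (\<lambda>\<omega>. H (future s \<omega>))"
    proof (rule integrable_const_bound[where B=c])
      show "AE \<omega> in M. norm (H (future s \<omega>)) \<le> c"
        using H(2)[OF measurable_space[OF measurable_future]] by auto
    qed (rule measurable_compose[OF measurable_future H(1)])
    show "integrable M (\<lambda>\<omega>. ?G (state s \<omega>))"
      using G_bound by (intro integrable_const_bound[where B=c] measurable_compose[OF measurable_state G]) auto
  qed (rule GX)
qed

lemma subalgebra_vimage: "subalgebra M (vimage_algebra (space M) (state s) state_space)"
  using sets_vimage_algebra2[of "state s" "space M" state_space] measurable_sets[OF measurable_state[of s]]
  by (auto simp: subalgebra_def space_pair_measure)

lemma markov_process_state: "markov_process M state_space state"
  unfolding markov_process_def
proof (intro conjI allI impI measurable_state)
  fix s t :: real and f :: "real \<times> nat \<Rightarrow> real"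
  assume s: "0 \<le> s" and t: "s \<le> t" and f: "f \<in> borel_measurable state_space \<and> bounded (f ` space state_space)"
  obtain c where c: "\<And>y. \<bar>f y\<bar> \<le> c"
    using f by (auto simp: bounded_iff space_pair_measure)
  define H where "H p = f (p (t - s))" for p
  have "(\<lambda>p. p (t - s)) \<in> path_space \<rightarrow>\<^sub>M state_space"
    using t by (intro measurable_component_singleton) auto
  hence H: "H \<in> borel_measurable path_space"
    unfolding H_def using conjunct1[OF f] by (rule measurable_compose)
  have H_eq: "H (future s \<omega>) = f (state t \<omega>)" for \<omega>
    using t by (simp add: H_def future_def)
  have bound: "\<bar>H p\<bar> \<le> c" for p unfolding H_def by (rule c)
  let ?G = "\<lambda>\<omega>. \<integral>w. H (restart a b (state s \<omega>) w) \<partial>waiting_law"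
  have "AE \<omega> in M. real_cond_exp M (natural_filtration M state_space state s) (\<lambda>\<omega>. f (state t \<omega>)) \<omega> = ?G \<omega>"
    using cond_exp_future[OF s subalgebra_natural_filtration order_refl
        vimage_subset_natural_filtration[OF s] H bound]
    by (simp only: H_eq)
  moreover have "AE \<omega> in M. real_cond_exp M (vimage_algebra (space M) (state s) state_space)
      (\<lambda>\<omega>. f (state t \<omega>)) \<omega> = ?G \<omega>"
    using cond_exp_future[OF s subalgebra_vimage vimage_subset_natural_filtration[OF s] order_refl H bound]
    by (simp only: H_eq)
  ultimately show "AE \<omega> in M. real_cond_exp M (natural_filtration M state_space state s) (\<lambda>\<omega>. f (state t \<omega>)) \<omega>
      = real_cond_exp M (vimage_algebra (space M) (state s) state_space) (\<lambda>\<omega>. f (state t \<omega>)) \<omega>"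
    by eventually_elim simp
qed

lemma cond_distributed_future:
  assumes s: "0 \<le> s"
  shows "cond_distributed M state_space (state s) path_space (future s)
    (\<lambda>y. distr waiting_law path_space (restart a b y))"
  unfolding cond_distributed_def
proof (intro conjI ballI measurable_state measurable_future measurable_restart_law)
  fix A assume A: "A \<in> sets path_space"
  have ind: "(indicator A :: _ \<Rightarrow> real) \<in> borel_measurable path_space"
    using A by (rule borel_measurable_indicator)
  have "(\<integral>w. indicator A (restart a b y w) \<partial>waiting_law)
      = measure (distr waiting_law path_space (restart a b y)) A" for y
  proof -
    have "(\<integral>w. indicator A (restart a b y w) \<partial>waiting_law)
      = (\<integral>p. indicator A p \<partial>distr waiting_law path_space (restart a b y) :: real)"
      by (rule integral_distr[symmetric, OF measurable_restart_fixed ind])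
    also have "\<dots> = measure (distr waiting_law path_space (restart a b y)) A"
      using sets.sets_into_space[OF A] by (simp add: Int_absorb2)
    finally show ?thesis .
  qed
  thus "AE \<omega> in M. real_cond_exp M (vimage_algebra (space M) (state s) state_space)
      (\<lambda>\<omega>. indicator A (future s \<omega>)) \<omega> = measure (distr waiting_law path_space (restart a b (state s \<omega>))) A"
    using cond_exp_future[OF s subalgebra_vimage vimage_subset_natural_filtration[OF s] order_refl ind, of 1]
    by (simp add: indicator_def)
qed

text \<open>
  The whole sequence of waiting times has law \<^const>\<open>waiting_law\<close>, so the kernel can be realised on the
  original probability space.
\<close>
lemma distr_restart:
  "distr waiting_law path_space (restart a b (x, n)) =
     (if even n then
        distr M path_space (\<lambda>\<omega>. \<lambda>t\<in>{0..}. (x + Z_proc e a b t \<omega>, n + N_proc e a b t \<omega>))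
      else
        distr M path_space (\<lambda>\<omega>. \<lambda>t\<in>{0..}. (x - Z_proc e b a t \<omega>, n + N_proc e b a t \<omega>)))"
proof -
  have w: "later_waits 0 \<omega> k = e k \<omega>" if "1 \<le> k" for k \<omega>
    using that by (simp add: later_waits_def)
  have "distr waiting_law path_space (restart a b (x, n))
      = distr (distr M (\<Pi>\<^sub>M k\<in>{1..}. borel) (later_waits 0)) path_space (restart a b (x, n))"
    by (simp only: distr_later_waits)
  also have "\<dots> = distr M path_space (restart a b (x, n) \<circ> later_waits 0)"
    using measurable_restart_fixed measurable_cong_sets[OF sets_waiting_law refl]
    by (intro distr_distr measurable_later_waits) blast
  also have "restart a b (x, n) \<circ> later_waits 0 =
     (if even n then (\<lambda>\<omega>. \<lambda>t\<in>{0..}. (x + Z_proc e a b t \<omega>, n + N_proc e a b t \<omega>))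
      else (\<lambda>\<omega>. \<lambda>t\<in>{0..}. (x - Z_proc e b a t \<omega>, n + N_proc e b a t \<omega>)))"
    using N_proc_path[of "later_waits 0 _" e, OF w] Z_proc_path[of "later_waits 0 _" e, OF w]
    by (cases "even n") (simp_all add: restart_def comp_def)
  finally show ?thesis unfolding if_distrib[of "distr M path_space"] .
qed

end

theorem proposition3p5:
  fixes M :: "'a measure" and e :: "nat \<Rightarrow> 'a \<Rightarrow> real" and c0 c1 :: real
  assumes "prob_space M"
    and "prob_space.indep_vars M (\<lambda>_. borel) e {1..}"
    and "\<And>k. 1 \<le> k \<Longrightarrow> distributed M lborel (e k) (exponential_density 1)"
    and "c0 > 0" and "c1 > 0"
  shows "markov_process M state_space (\<lambda>t \<omega>. (Z_proc e c0 c1 t \<omega>, N_proc e c0 c1 t \<omega>)) \<and>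
    (\<forall>s\<ge>0. cond_distributed M
       state_space (\<lambda>\<omega>. (Z_proc e c0 c1 s \<omega>, N_proc e c0 c1 s \<omega>))
       path_space (\<lambda>\<omega>. \<lambda>t\<in>{0..}. (Z_proc e c0 c1 (t + s) \<omega>, N_proc e c0 c1 (t + s) \<omega>))
       (\<lambda>(x, n).
          if even n then
            distr M path_space (\<lambda>\<omega>. \<lambda>t\<in>{0..}.
              (x + (LBINT u:{0..t}. (-1) ^ N_proc e c0 c1 u \<omega>), n + N_proc e c0 c1 t \<omega>))
          else
            distr M path_space (\<lambda>\<omega>. \<lambda>t\<in>{0..}.
              (x - (LBINT u:{0..t}. (-1) ^ N_proc e c1 c0 u \<omega>), n + N_proc e c1 c0 t \<omega>))))"
proof -
  interpret prob_space M by (rule assms(1))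
  interpret alternating_process M e c0 c1
    using assms by unfold_locales auto
  have process: "(\<lambda>t \<omega>. (Z_proc e c0 c1 t \<omega>, N_proc e c0 c1 t \<omega>)) = state"
    by (simp add: state_def fun_eq_iff)
  have process_at: "(\<lambda>\<omega>. (Z_proc e c0 c1 s \<omega>, N_proc e c0 c1 s \<omega>)) = state s" for s
    by (simp add: state_def fun_eq_iff)
  have future: "(\<lambda>\<omega>. \<lambda>t\<in>{0..}. (Z_proc e c0 c1 (t + s) \<omega>, N_proc e c0 c1 (t + s) \<omega>)) = future s" for s
    by (simp add: state_def future_def fun_eq_iff)
  have kernel: "(\<lambda>(x, n).
          if even n then
            distr M path_space (\<lambda>\<omega>. \<lambda>t\<in>{0..}.
              (x + (LBINT u:{0..t}. (-1) ^ N_proc e c0 c1 u \<omega>), n + N_proc e c0 c1 t \<omega>))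
          else
            distr M path_space (\<lambda>\<omega>. \<lambda>t\<in>{0..}.
              (x - (LBINT u:{0..t}. (-1) ^ N_proc e c1 c0 u \<omega>), n + N_proc e c1 c0 t \<omega>)))
      = (\<lambda>y. distr waiting_law path_space (restart c0 c1 y))"
    by (rule ext, clarify) (simp only: prod.case distr_restart Z_proc_def)
  show ?thesis
    unfolding process process_at future kernel using markov_process_state cond_distributed_future by blast
qed

end
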